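(* Consider the linear parameter varying (LPV) setup of the context. Suppose $(A_0,B_0)$ is stabilizable, i.e. there exists a feedback $K$ such that $A_K:=A_0+B_0K$ is Schur. 1) There exists a compact polytope $\mathcal{P}=\{x\in\mathbb{R}^n: P_ix\le1,\ i=1,\dots,r\}$ with $A_K\mathcal{P}\subseteq\rho\mathcal{P}$, $\rho\in[0,1)$. The functions $V_\delta:\mathbb{R}^n\times\mathcal{Z}\to\mathbb{R}_{\ge0}$ and $\kappa:\mathbb{R}^n\times\mathcal{Z}\to\mathbb{R}^m$ given by $\sqrt{V_\delta(x,z,v)}=\max_iP_i(x-z)$ and $\kappa(x,z,v)=v+K(x-z)$ have the following incremental stabilizability property: $V_\delta$ is continuous in the first argument, $V_\delta(z,z,v)=0$, and for some constants $c_{\delta,l},c_{\delta,u},\delta_{loc},\kappa_{\max}>0$ (here $\delta_{loc}$ can be arbitrarily large) and the contraction rate $\rho$, for all $(x,z,v)\in\mathbb{R}^n\times\mathcal{Z}$ with $V_\delta(x,z,v)\le\delta_{loc}$ and all $(x^+,z^+,v^+)\in\mathbb{R}^n\times\mathcal{Z}$ with $x^+=f(x,\kappa(x,z,v))$, $z^+=f(z,v)$: $c_{\delta,l}\|x-z\|^2\le V_\delta(x,z,v)\le c_{\delta,u}\|x-z\|^2$; $\|\kappa(x,z,v)-v\|^2\le\kappa_{\max}V_\delta(x,z,v)$; $V_\delta(x^+,z^+,v^+)\le\rho^2V_\delta(x,z,v)$. Furthermore, the constants $c_j:=\max_{x\in\mathcal{P}}[L_{j,x}+L_{j,u}K]x$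 satisfy: $g_j(x,\kappa(x,z,v))-g_j(z,v)\le c_jc$ for all $(x,z,v)\in\mathbb{R}^n\times\mathcal{Z}$ with $V_\delta(x,z,v)\le c^2$ and $c\in[0,\sqrt{\delta_{loc}}]$, $j=1,\dots,p$. 2) Denote the vertices of $\Theta$ by $\theta^j$. The function $$\tilde w_\delta(z,v,c):=\tilde w(z,v)+L_wc,\qquad \tilde w(z,v):=\max_{i,j}P_i[A_{\theta^j}z+B_{\theta^j}v]+\overline d_i,$$ $$L_w:=\max_{i,j}\max_{\Delta x\in\mathcal{P}}P_i(A_{\theta^j}+B_{\theta^j}K)\Delta x,\qquad \overline d_i:=\max_{d\in\mathbb{D}}P_iEd,\ i=1,\dots,r,$$ (with values in $\mathbb{R}_{\ge0}$) satisfies: (a) for any $c\in[0,\sqrt{\delta_{loc}}]$, any $(x,z,v)\in\mathbb{R}^n\times\mathcal{Z}$ with $V_\delta(x,z,v)\le c^2$, any $(z^+,v^+)\in\mathcal{Z}$ with $z^+=f(z,v)$ and any $d_w\in\mathcal{W}(x,\kappa(x,z,v))$: $V_\delta(z^++d_w,z^+,v^+)\le\tilde w_\delta^2(z,v,c)$; (b) for any $0\le c_2\le c_1\le\sqrt{\delta_{loc}}$ and $(x,z,v)\in\mathbb{R}^n\times\mathcal{Z}$ with $V_\delta(x,z,v)\le(c_1-c_2)^2$: $\tilde w_\delta(x,\kappa(x,z,v),c_2)\le\tilde w_\delta(z,v,c_1)$. 3) Denote $c_{\max}:=\max_{j=1,\dots,p}c_j$, $\overline d:=\max_{i=1,\dots,r}\overline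 d_i$, $\overline w_{\min}:=\inf_{(x,u)\in\mathcal{Z}}\tilde w_\delta(x,u,0)$, let $N\in\mathbb{N}$ be the prediction horizon, and assume further that $\rho+L_w+c_{\max}\overline d\le1$. Set $\overline w=\overline s=\infty$, $k_f(x)=Kx$, $V_f(x)=x^\top P_fx$ where $P_f=A_K^\top P_fA_K+Q+K^\top RK$, and $$\mathcal{X}_f:=\{(x,s)\in\mathbb{R}^n\times\mathbb{R}_{\ge0}:\ P_ix+s\le1/c_{\max},\ i=1,\dots,r\}.$$ Then for all $(x,s)\in\mathcal{X}_f$, all (finite) $w\in[\overline w_{\min},\overline w]$, all $s^+\in[0,\rho s-\rho^Nw+\tilde w_\delta(x,k_f(x),s)]$ and all $d_w\in\mathbb{R}^n$ with $V_\delta(x^++d_w,x^+,k_f(x^+))\le\rho^{2N}w^2$, where $x^+=f(x,k_f(x))$: $V_f(x^+)\le V_f(x)-\ell(x,k_f(x))$; $(x^++d_w,s^+)\in\mathcal{X}_f$; $\tilde w_\delta(x,k_f(x),s)\le\overline w$; $g_j(x,k_f(x))+c_js\le0$ for $j=1,\dots,p$; $s\le\overline s$. Furthermore, $\mathcal{X}_{f,x}:=\{x:\exists s\in[0,\overline s],(x,s)\in\mathcal{X}_f\}$ is compact and there is a continuous, strictly increasing, unbounded $\alpha_f:\mathbb{R}_{\ge0}\to\mathbb{R}_{\ge0}$ with $\alpha_f(0)=0$ and $V_f(z)\le V_f(x)+\alpha_f(\|x-z\|)$ for all $x,z\in\mathcal{X}_{f,x}$.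
   Context: LPV setup. $x_{t+1}=(A_0+A_{\theta_t})x_t+(B_0+B_{\theta_t})u_t+Ed_t$, $x\in\mathbb{R}^n$, $u\in\mathbb{R}^m$, with $A_\theta=\sum_{i=1}^q\theta_iA_i$, $B_\theta=\sum_{i=1}^q\theta_iB_i$; the unknown time-varying parameters and additive disturbances satisfy $\theta_t\in\Theta\subset\mathbb{R}^q$ and $d_t\in\mathbb{D}$ for all $t\ge0$, with $\Theta,\mathbb{D}$ (compact) polytopes. Nominal model: $f(x,u)=A_0x+B_0u$. The disturbance set is $\mathcal{W}(x,u)=\{A_\theta x+B_\theta u+Ed:\theta\in\Theta,d\in\mathbb{D}\}$. Constraint set: the compact polytope $\mathcal{Z}=\{(x,u):g_j(x,u)\le0,j=1,\dots,p\}$ with $g_j(x,u)=L_{j,x}x+L_{j,u}u-1$. Stage cost: $\ell(x,u)=x^\top Qx+u^\top Ru$, $Q,R$ positive definite. $\|\cdot\|$ is the Euclidean norm; the $P_i$ are row vectors. *)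

theory Defs
  imports "HOL-Analysis.Analysis"
begin

definition positive_definite :: "real^'n^'n \<Rightarrow> bool" where
  "positive_definite Q \<longleftrightarrow> transpose Q = Q \<and> (\<forall>x. x \<noteq> 0 \<longrightarrow> 0 < x \<bullet> (Q *v x))"

definition complex_eigenvalue :: "real^'n^'n \<Rightarrow> complex \<Rightarrow> bool" where
  "complex_eigenvalue A l \<longleftrightarrow>
     (\<exists>y :: complex^'n. y \<noteq> 0 \<and> map_matrix complex_of_real A *v y = l *s y)"

definition schur :: "real^'n^'n \<Rightarrow> bool" where
  "schur A \<longleftrightarrow> (\<forall>l. complex_eigenvalue A l \<longrightarrow> cmod l < 1)"

definition stabilizable :: "real^'n^'n \<Rightarrow> real^'m^'n \<Rightarrow> bool" where
  "stabilizable A B \<longleftrightarrow> (\<exists>K :: real^'n^'m. schur (A + B ** K))"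

definition class_K_inf :: "(real \<Rightarrow> real) \<Rightarrow> bool" where
  "class_K_inf \<alpha> \<longleftrightarrow> \<alpha> \<in> {0..} \<rightarrow> {0..} \<and> continuous_on {0..} \<alpha> \<and> strict_mono_on {0..} \<alpha> \<and>
     \<not> bdd_above (\<alpha> ` {0..}) \<and> \<alpha> 0 = 0"

definition vertices :: "'a::real_vector set \<Rightarrow> 'a set" where
  "vertices S = {v. v extreme_point_of S}"

text \<open>With \<open>M i\<close> for \<open>A\<^sub>i\<close> or \<open>B\<^sub>i\<close>, this is \<open>A\<^sub>\<theta>\<close> or \<open>B\<^sub>\<theta>\<close>.\<close>

definition lin_param :: "('q::finite \<Rightarrow> real^'b^'a) \<Rightarrow> real^'q \<Rightarrow> real^'b^'a" where
  "lin_param M \<theta> = (\<Sum>i\<in>UNIV. (\<theta> $ i) *\<^sub>R M i)"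

definition nominal :: "real^'n^'n \<Rightarrow> real^'m^'n \<Rightarrow> real^'n \<Rightarrow> real^'m \<Rightarrow> real^'n" where
  "nominal A\<^sub>0 B\<^sub>0 x u = A\<^sub>0 *v x + B\<^sub>0 *v u"

definition disturbance_set ::
  "('q::finite \<Rightarrow> real^'n^'n) \<Rightarrow> ('q \<Rightarrow> real^'m^'n) \<Rightarrow> real^'d^'n \<Rightarrow> (real^'q) set \<Rightarrow> (real^'d) set
    \<Rightarrow> real^'n \<Rightarrow> real^'m \<Rightarrow> (real^'n) set" where
  "disturbance_set A B E \<Theta> D x u =
     {lin_param A \<theta> *v x + lin_param B \<theta> *v u + E *v d | \<theta> d. \<theta> \<in> \<Theta> \<and> d \<in> D}"

definition constr :: "(nat \<Rightarrow> real^'n) \<Rightarrow> (nat \<Rightarrow> real^'m) \<Rightarrow> nat \<Rightarrow> real^'n \<Rightarrow> real^'m \<Rightarrow> real" where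
  "constr Lx Lu j x u = Lx j \<bullet> x + Lu j \<bullet> u - 1"

definition constr_set ::
  "nat \<Rightarrow> (nat \<Rightarrow> real^'n) \<Rightarrow> (nat \<Rightarrow> real^'m) \<Rightarrow> ((real^'n) \<times> (real^'m)) set" where
  "constr_set p Lx Lu = {(x, u). \<forall>j\<in>{1..p}. constr Lx Lu j x u \<le> 0}"

definition stage_cost :: "real^'n^'n \<Rightarrow> real^'m^'m \<Rightarrow> real^'n \<Rightarrow> real^'m \<Rightarrow> real" where
  "stage_cost Q R x u = x \<bullet> (Q *v x) + u \<bullet> (R *v u)"

definition poly_set :: "nat \<Rightarrow> (nat \<Rightarrow> real^'n) \<Rightarrow> (real^'n) set" where
  "poly_set r P = {x. \<forall>i\<in>{1..r}. P i \<bullet> x \<le> 1}"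

definition contractive_polytope :: "real^'n^'n \<Rightarrow> nat \<Rightarrow> (nat \<Rightarrow> real^'n) \<Rightarrow> real \<Rightarrow> bool" where
  "contractive_polytope A r P \<rho> \<longleftrightarrow> compact (poly_set r P) \<and> 0 \<le> \<rho> \<and> \<rho> < 1 \<and>
     (\<lambda>x. A *v x) ` poly_set r P \<subseteq> (\<lambda>x. \<rho> *\<^sub>R x) ` poly_set r P"

definition V_delta :: "nat \<Rightarrow> (nat \<Rightarrow> real^'n) \<Rightarrow> real^'n \<Rightarrow> real^'n \<Rightarrow> real^'m \<Rightarrow> real" where
  "V_delta r P x z v = (MAX i\<in>{1..r}. P i \<bullet> (x - z))\<^sup>2"

definition feedback :: "real^'n^'m \<Rightarrow> real^'n \<Rightarrow> real^'n \<Rightarrow> real^'m \<Rightarrow> real^'m" where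
  "feedback K x z v = v + K *v (x - z)"

text \<open>Maxima over the polytopes \<open>poly_set r P\<close> and \<open>D\<close> are suprema over nonempty compact sets
  below; maxima over indices and vertices are maxima of finite sets.\<close>

definition tightening ::
  "(nat \<Rightarrow> real^'n) \<Rightarrow> (nat \<Rightarrow> real^'m) \<Rightarrow> real^'n^'m \<Rightarrow> nat \<Rightarrow> (nat \<Rightarrow> real^'n) \<Rightarrow> nat \<Rightarrow> real" where
  "tightening Lx Lu K r P j = (SUP x\<in>poly_set r P. Lx j \<bullet> x + Lu j \<bullet> (K *v x))"

definition d_bar :: "real^'d^'n \<Rightarrow> (real^'d) set \<Rightarrow> (nat \<Rightarrow> real^'n) \<Rightarrow> nat \<Rightarrow> real" where
  "d_bar E D P i = (SUP d\<in>D. P i \<bullet> (E *v d))"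

definition w_tilde ::
  "('q::finite \<Rightarrow> real^'n^'n) \<Rightarrow> ('q \<Rightarrow> real^'m^'n) \<Rightarrow> real^'d^'n \<Rightarrow> (real^'q) set \<Rightarrow> (real^'d) set
    \<Rightarrow> nat \<Rightarrow> (nat \<Rightarrow> real^'n) \<Rightarrow> real^'n \<Rightarrow> real^'m \<Rightarrow> real" where
  "w_tilde A B E \<Theta> D r P z v =
     (MAX (i, \<theta>)\<in>{1..r} \<times> vertices \<Theta>.
        P i \<bullet> (lin_param A \<theta> *v z + lin_param B \<theta> *v v) + d_bar E D P i)"

definition L_w ::
  "('q::finite \<Rightarrow> real^'n^'n) \<Rightarrow> ('q \<Rightarrow> real^'m^'n) \<Rightarrow> (real^'q) set \<Rightarrow> real^'n^'m
    \<Rightarrow> nat \<Rightarrow> (nat \<Rightarrow> real^'n) \<Rightarrow> real" where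
  "L_w A B \<Theta> K r P =
     (MAX (i, \<theta>)\<in>{1..r} \<times> vertices \<Theta>.
        SUP dx\<in>poly_set r P. P i \<bullet> ((lin_param A \<theta> + lin_param B \<theta> ** K) *v dx))"

definition w_delta ::
  "('q::finite \<Rightarrow> real^'n^'n) \<Rightarrow> ('q \<Rightarrow> real^'m^'n) \<Rightarrow> real^'d^'n \<Rightarrow> (real^'q) set \<Rightarrow> (real^'d) set
    \<Rightarrow> real^'n^'m \<Rightarrow> nat \<Rightarrow> (nat \<Rightarrow> real^'n) \<Rightarrow> real^'n \<Rightarrow> real^'m \<Rightarrow> real \<Rightarrow> real" where
  "w_delta A B E \<Theta> D K r P z v c = w_tilde A B E \<Theta> D r P z v + L_w A B \<Theta> K r P * c"

definition terminal_set :: "nat \<Rightarrow> (nat \<Rightarrow> real^'n) \<Rightarrow> real \<Rightarrow> ((real^'n) \<times> real) set" where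
  "terminal_set r P c_max = {(x, s). 0 \<le> s \<and> (\<forall>i\<in>{1..r}. P i \<bullet> x + s \<le> 1 / c_max)}"

end

theory Submission
  imports Defs "HOL-Computational_Algebra.Fundamental_Theorem_Algebra"
begin

text \<open>
  Since \<open>A\<^sub>K\<close> is Schur, \<open>A\<^sub>K\<^sup>k y \<longrightarrow> 0\<close> for every \<open>y\<close>: a polynomial annihilating \<open>y\<close> splits over the
  complex numbers, and its linear factors are removed one at a time. Hence
  \<open>{x. \<bar>(A\<^sub>K\<^sup>k x)\<^sub>i\<bar> \<le> \<rho>\<^sup>k, k < N}\<close> is a contractive polytope as soon as \<open>A\<^sub>K\<^sup>N\<close> maps the unit cube into
  \<open>\<rho>\<^sup>N\<close> times itself, and \<open>X \<mapsto> X - A\<^sub>K\<^sup>T X A\<^sub>K\<close> is injective, hence bijective.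

  For a contractive polytope, \<open>sqrt V\<^sub>\<delta>\<close> is the Minkowski gauge of the polytope at \<open>x - z\<close>. All
  estimates follow from the fact that a linear functional at \<open>y\<close> is at most its maximum over the
  polytope times the gauge of \<open>y\<close>, together with the fact that a functional linear in \<open>\<theta>\<close> is
  maximal at a vertex of \<open>\<Theta>\<close>. The terminal condition reads: gauge of \<open>x\<close> plus \<open>s\<close> is at most
  \<open>1 / c\<^sub>m\<^sub>a\<^sub>x\<close>, and one step multiplies this sum by at most \<open>\<rho> + L\<^sub>w\<close> and adds at most \<open>d\<^sub>m\<^sub>a\<^sub>x\<close>.
\<close>

section \<open>Powers of Schur matrices\<close>

text \<open>Once \<open>e\<close> is small, the excess of \<open>s\<close> over a chosen level is
  multiplied by at most \<open>c\<close> per step and so decays geometrically. It is applied to the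
  moduli of the components of matrix iterates.\<close>

lemma perturbed_contraction_tendsto_0:
  fixes s e :: "nat \<Rightarrow> real"
  assumes c: "0 \<le> c" "c < 1" and s: "\<And>k. 0 \<le> s k" and e: "e \<longlonglongrightarrow> 0"
    and rec: "\<And>k. s (Suc k) \<le> c * s k + e k"
  shows "s \<longlonglongrightarrow> 0"
proof (rule LIMSEQ_I)
  fix \<epsilon> :: real assume \<epsilon>: "0 < \<epsilon>"
  \<comment> \<open>Chosen so that \<open>\<epsilon> / 2\<close> is the fixed point of multiplying
    by \<open>c\<close> and adding \<open>\<eta>\<close>.\<close>
  define \<eta> where "\<eta> = (1 - c) * (\<epsilon> / 2)"
  have "0 < \<eta>" using \<epsilon> c by (simp add: \<eta>_def)
  then obtain n\<^sub>0 where n0: "\<And>k. k \<ge> n\<^sub>0 \<Longrightarrow> \<bar>e k\<bar> < \<eta>"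
    using LIMSEQ_D[OF e] by force
  have step: "s (n\<^sub>0 + n) \<le> c ^ n * s n\<^sub>0 + \<epsilon> / 2" for n
  proof (induction n)
    case 0 show ?case using \<epsilon> by simp
  next
    case (Suc n)
    have "s (n\<^sub>0 + Suc n) \<le> c * s (n\<^sub>0 + n) + \<eta>"
      using rec[of "n\<^sub>0 + n"] n0[of "n\<^sub>0 + n"] by simp
    also have "\<dots> \<le> c * (c ^ n * s n\<^sub>0 + \<epsilon> / 2) + \<eta>"
      using Suc c by (simp add: mult_left_mono)
    also have "\<dots> = c ^ Suc n * s n\<^sub>0 + \<epsilon> / 2"
      by (simp add: \<eta>_def field_simps)
    finally show ?case .
  qed
  have "(\<lambda>n. c ^ n * s n\<^sub>0) \<longlonglongrightarrow> 0"
    using tendsto_mult_left_zero[OF LIMSEQ_realpow_zero[OF c]] by simp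
  then obtain n\<^sub>1 where n1: "\<And>n. n \<ge> n\<^sub>1 \<Longrightarrow> \<bar>c ^ n * s n\<^sub>0\<bar> < \<epsilon> / 2"
    using LIMSEQ_D[of _ 0 "\<epsilon> / 2"] \<epsilon> by force
  show "\<exists>no. \<forall>n\<ge>no. norm (s n - 0) < \<epsilon>"
  proof (intro exI allI impI)
    fix n assume "n\<^sub>0 + n\<^sub>1 \<le> n"
    then obtain m where "n = n\<^sub>0 + m" "m \<ge> n\<^sub>1" by (metis add.assoc le_Suc_ex le_add1)
    then show "norm (s n - 0) < \<epsilon>" using step[of m] n1[of m] s[of n] by auto
  qed
qed

section \<open>Polynomials in a matrix, evaluated at a vector\<close>

definition poly_apply :: "'a::field^'n^'n \<Rightarrow> 'a poly \<Rightarrow> 'a^'n \<Rightarrow> 'a^'n" where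
  "poly_apply A q y = (\<Sum>i\<le>degree q. coeff q i *s (((*v) A ^^ i) y))"

text \<open>Padding with zero coefficients gives polynomials of different degrees a common summation
  range, as additivity requires.\<close>

lemma poly_apply_le:
  assumes "degree q \<le> n"
  shows "poly_apply A q y = (\<Sum>i\<le>n. coeff q i *s (((*v) A ^^ i) y))"
  unfolding poly_apply_def using assms
  by (intro sum.mono_neutral_left) (auto simp: coeff_eq_0)

lemma poly_apply_add: "poly_apply A (p + q) y = poly_apply A p y + poly_apply A q y"
  using degree_add_le_max[of p q]
  by (simp add: poly_apply_le[where n = "max (degree p) (degree q)"]
      sum.distrib vec.scale_left_distrib)

lemma poly_apply_smult: "poly_apply A (smult a q) y = a *s poly_apply A q y"
  using degree_smult_le[of a q]
  by (simp add: poly_apply_le[where n = "degree q"] vec.scale_sum_right)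

lemma poly_apply_X_mult: "poly_apply A (pCons 0 q) y = poly_apply A q (A *v y)"
proof -
  have "poly_apply A (pCons 0 q) y = (\<Sum>i\<le>Suc (degree q). coeff (pCons 0 q) i *s (((*v) A ^^ i) y))"
    by (rule poly_apply_le) (rule degree_pCons_le)
  also have "\<dots> = (\<Sum>i\<le>degree q. coeff q i *s (((*v) A ^^ i) (A *v y)))"
    by (subst sum.atMost_Suc_shift) (simp add: funpow_swap1)
  finally show ?thesis by (simp add: poly_apply_def)
qed

lemma poly_apply_matrix: "poly_apply A q (A *v y) = A *v poly_apply A q y"
  by (simp only: poly_apply_def vec.linear_sum[OF matrix_vector_mul_linear_gen]
      vector_scalar_commute funpow_swap1)

lemma poly_apply_diff_arg: "poly_apply A q (x - y) = poly_apply A q x - poly_apply A q y"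
proof -
  have "((*v) A ^^ i) (x - y) = ((*v) A ^^ i) x - ((*v) A ^^ i) y" for i
    by (induction i) (simp_all add: matrix_vector_mult_diff_distrib)
  then show ?thesis by (simp add: poly_apply_def sum_subtractf vec.scale_right_diff_distrib)
qed

lemma poly_apply_scale_arg: "poly_apply A q (c *s y) = c *s poly_apply A q y"
proof -
  have "((*v) A ^^ i) (c *s y) = c *s ((*v) A ^^ i) y" for i
    by (induction i) (simp_all add: vector_scalar_commute)
  then show ?thesis by (simp add: poly_apply_def vec.scale_sum_right mult.commute)
qed

text \<open>The first form exhibits an eigenvector equation for \<open>poly_apply A q y\<close> when
  the product annihilates \<open>y\<close>; the second moves the factor onto the vector, leaving one
  annihilated by \<open>q\<close>.\<close>

lemma poly_apply_linear_factor:
  "poly_apply A ([:- l, 1:] * q) y = A *v poly_apply A q y - l *s poly_apply A q y"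
  "poly_apply A ([:- l, 1:] * q) y = poly_apply A q (A *v y - l *s y)"
proof -
  have "[:- l, 1:] * q = smult (- l) q + pCons 0 q" by simp
  then show "poly_apply A ([:- l, 1:] * q) y = A *v poly_apply A q y - l *s poly_apply A q y"
    "poly_apply A ([:- l, 1:] * q) y = poly_apply A q (A *v y - l *s y)"
    by (simp_all only: poly_apply_add poly_apply_smult poly_apply_X_mult poly_apply_matrix
      poly_apply_diff_arg poly_apply_scale_arg) simp_all
qed

text \<open>The vectors y, A y, ..., A^n y, with n the real dimension, outnumber that dimension. A
  real linear dependence among them supplies the coefficients.\<close>

lemma exists_annihilating_poly:
  fixes A :: "complex^'n^'n"
  shows "\<exists>q. q \<noteq> 0 \<and> poly_apply A q y = 0"
proof -
  define v where "v = (\<lambda>i. ((*v) A ^^ i) y)"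
  let ?n = "DIM(complex^'n)"
  have monom: "poly_apply A (monom c i) y = c *s v i" for c i
    by (cases "c = 0") (auto simp: poly_apply_def v_def degree_monom_eq if_distrib[of "\<lambda>a. a *s _"]
        cong: if_cong)
  show ?thesis
  \<comment> \<open>Dependence is a property of the set of iterates and does not see repetitions; a
    repeated iterate is annihilated directly by a difference of two monomials.\<close>
  proof (cases "inj_on v {..?n}")
    case False
    then obtain i j where ij: "v i = v j" "i \<noteq> j" by (auto simp: inj_on_def)
    let ?q = "monom 1 i + smult (- 1) (monom 1 j) :: complex poly"
    have "poly_apply A ?q y = 0"
      by (simp only: poly_apply_add poly_apply_smult monom) (simp add: ij)
    moreover have "coeff ?q i \<noteq> 0" using ij by simp
    ultimately show ?thesis by (metis coeff_0)
  next
    case True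
    then have "card (v ` {..?n}) > ?n" by (simp add: card_image)
    then have "dependent (v ` {..?n})" by (intro dependent_biggerset) auto
    then obtain u x where u: "(\<Sum>x\<in>v ` {..?n}. u x *\<^sub>R x) = 0" and x: "x \<in> v ` {..?n}" "u x \<noteq> 0"
      by (subst (asm) dependent_finite) auto
    from x obtain k where k: "k \<le> ?n" "u (v k) \<noteq> 0" by auto
    let ?q = "\<Sum>i\<le>?n. monom (complex_of_real (u (v i))) i"
    have "poly_apply A (\<Sum>i\<in>S. monom (complex_of_real (u (v i))) i) y
        = (\<Sum>i\<in>S. u (v i) *\<^sub>R v i)" if "finite S" for S
      using that by induction
        (simp_all add: poly_apply_add monom poly_apply_def[of A 0]  vec_eq_iff scaleR_conv_of_real[where 'a=complex])
    then have "poly_apply A ?q y = 0" using u True by (simp add: sum.reindex)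
    moreover have "coeff ?q k \<noteq> 0"
      using k by (simp add: coeff_sum if_distrib cong: if_cong)
    ultimately show ?thesis by (metis coeff_0)
  qed
qed

text \<open>Induction on the degree: a factor \<open>X - l\<close> with \<open>cmod l \<ge> 1\<close> is injective and can be cancelled;
  if \<open>cmod l < 1\<close>, then \<open>A\<^sup>k y\<close> obeys the scalar recursion \<open>a\<^sub>k\<^sub>+\<^sub>1 = l a\<^sub>k + A\<^sup>k z\<close> with \<open>z = A y - l y\<close>, and
  \<open>z\<close> is annihilated by the remaining factor.\<close>

lemma annihilated_tendsto_0:
  fixes A :: "complex^'n^'n"
  assumes A: "\<And>l y. y \<noteq> 0 \<Longrightarrow> A *v y = l *s y \<Longrightarrow> cmod l < 1"
    and "q \<noteq> 0" "poly_apply A q y = 0"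
  shows "(\<lambda>k. ((*v) A ^^ k) y) \<longlonglongrightarrow> 0"
  using assms(2,3)
proof (induction "degree q" arbitrary: q y)
  case 0
  then obtain c where "q = [:c:]" by (metis degree_eq_zeroE)
  then have "y = 0" using 0 by (simp add: poly_apply_def)
  moreover have "((*v) A ^^ k) 0 = 0" for k by (induction k) simp_all
  ultimately show ?case by simp
next
  case (Suc d)
  then obtain l where "poly q l = 0"
    using fundamental_theorem_of_algebra constant_degree by (metis nat.distinct(1))
  then obtain q' where q': "q = [:- l, 1:] * q'" by (metis dvdE poly_eq_0_iff_dvd)
  then have "q' \<noteq> 0" using Suc.prems by auto
  then have d: "d = degree q'" using Suc.hyps(2) degree_mult_eq[of "[:- l, 1:]" q'] by (simp add: q')
  show ?case
  proof (cases "cmod l < 1")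
    case False
    have "A *v poly_apply A q' y = l *s poly_apply A q' y"
      using Suc.prems q' poly_apply_linear_factor(1) by (metis right_minus_eq)
    then have "poly_apply A q' y = 0" using False A by blast
    then show ?thesis using Suc.hyps(1)[OF d] \<open>q' \<noteq> 0\<close> by blast
  next
    case True
    define z where "z = A *v y - l *s y"
    have "poly_apply A q' z = 0"
      using Suc.prems q' poly_apply_linear_factor(2) unfolding z_def by metis
    then have z: "(\<lambda>k. ((*v) A ^^ k) z) \<longlonglongrightarrow> 0" using Suc.hyps(1)[OF d] \<open>q' \<noteq> 0\<close> by blast
    have rec: "((*v) A ^^ Suc k) y = l *s ((*v) A ^^ k) y + ((*v) A ^^ k) z" for k
      by (induction k)
        (simp_all add: z_def matrix_vector_right_distrib matrix_vector_mult_diff_distrib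
          vector_scalar_commute)
    show ?thesis
    proof (rule vec_tendstoI)
      fix i
      have "(\<lambda>k. cmod ((((*v) A ^^ k) y) $ i)) \<longlonglongrightarrow> 0"
      proof (rule perturbed_contraction_tendsto_0)
        show "(\<lambda>k. cmod ((((*v) A ^^ k) z) $ i)) \<longlonglongrightarrow> 0"
          using tendsto_norm_zero[of "\<lambda>k. (((*v) A ^^ k) z) $ i"] tendsto_vec_nth[OF z, of i] by simp
        show "cmod ((((*v) A ^^ Suc k) y) $ i)
          \<le> cmod l * cmod ((((*v) A ^^ k) y) $ i) + cmod ((((*v) A ^^ k) z) $ i)" for k
          unfolding rec by (simp add: norm_triangle_le norm_mult)
      qed (use True in auto)
      then show "(\<lambda>k. (((*v) A ^^ k) y) $ i) \<longlonglongrightarrow> 0 $ i"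
        by (simp add: tendsto_norm_zero_iff)
    qed
  qed
qed

text \<open>Splitting into linear factors requires complex scalars. The componentwise embedding
  \<open>c\<close> commutes with the iteration, and convergence of the embedded components is
  equivalent to real convergence.\<close>

lemma schur_funpow_tendsto_0:
  fixes A :: "real^'n^'n"
  assumes "schur A"
  shows "(\<lambda>k. ((*v) A ^^ k) y) \<longlonglongrightarrow> 0"
proof -
  define C where "C = map_matrix complex_of_real A"
  define c where "c = (\<lambda>y :: real^'n. \<chi> i. complex_of_real (y $ i))"
  have C: "C *v c y = c (A *v y)" for y
    by (simp add: C_def c_def map_matrix_def matrix_vector_mult_def vec_eq_iff)
  then have Ck: "((*v) C ^^ k) (c y) = c (((*v) A ^^ k) y)" for k
    by (induction k) auto
  obtain q where "q \<noteq> 0" "poly_apply C q (c y) = 0" using exists_annihilating_poly by blast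
  moreover have "cmod l < 1" if "v \<noteq> 0" "C *v v = l *s v" for l v
    using assms that unfolding schur_def complex_eigenvalue_def C_def by auto
  ultimately have "(\<lambda>k. ((*v) C ^^ k) (c y)) \<longlonglongrightarrow> 0"
    by (intro annihilated_tendsto_0[of C q "c y"])
  then have lim: "(\<lambda>k. c (((*v) A ^^ k) y)) \<longlonglongrightarrow> 0" by (simp only: Ck)
  have "(\<lambda>k. complex_of_real ((((*v) A ^^ k) y) $ i)) \<longlonglongrightarrow> of_real 0" for i
    using tendsto_vec_nth[OF lim, of i] by (simp add: c_def)
  then show ?thesis by (intro vec_tendstoI) (simp only: tendsto_of_real_iff zero_index)
qed

lemma linear_funpow_matrix: "linear (((*v) (A :: real^'n^'n)) ^^ k)"
proof (induction k)
  case 0 show ?case by (simp add: linear_id[unfolded id_def] id_def)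
next
  case (Suc k) then show ?case using linear_compose[OF Suc matrix_vector_mul_linear[of A]] by (simp add: o_def)
qed

section \<open>Contractive polytopes and Lyapunov equations\<close>

lemma closed_poly_set: "closed (poly_set r P)"
proof -
  have "poly_set r P = (\<Inter>i\<in>{1..r}. {x. P i \<bullet> x \<le> 1})" by (auto simp: poly_set_def)
  then show ?thesis by (auto intro: closed_halfspace_le)
qed

lemma schur_imp_contractive_polytope:
  fixes A :: "real^'n^'n"
  assumes "schur A"
  shows "\<exists>r P \<rho>. contractive_polytope A r P \<rho>"
proof -
  define a where "a k = ((*v) A ^^ k)" for k
  have lin: "linear (a k)" for k by (simp add: a_def linear_funpow_matrix)
  \<comment> \<open>Each component of the image of a unit cube point is a sum of
    \<open>CARD('n)\<close> terms, each at most \<open>\<epsilon>\<close>, hence at most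
    1/2.\<close>
  define \<epsilon> where "\<epsilon> = 1 / (2 * real CARD('n))"
  have "0 < \<epsilon>" by (simp add: \<epsilon>_def)
  have "\<forall>\<^sub>F k in sequentially. \<bar>a k (axis j 1) $ i\<bar> < \<epsilon>" for i j
    using tendstoD[OF tendsto_vec_nth[OF schur_funpow_tendsto_0[OF assms]] \<open>0 < \<epsilon>\<close>]
    by (simp add: a_def)
  then have "\<forall>\<^sub>F k in sequentially. \<forall>i j. \<bar>a k (axis j 1) $ i\<bar> < \<epsilon>"
    by (simp add: eventually_all_finite)
  then have "\<forall>\<^sub>F k in sequentially. (\<forall>i j. \<bar>a k (axis j 1) $ i\<bar> < \<epsilon>) \<and> k \<ge> 1"
    by (intro eventually_conj eventually_ge_at_top)
  then obtain N where N: "\<And>i j. \<bar>a N (axis j 1) $ i\<bar> < \<epsilon>" "N \<ge> 1"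
    using eventually_happens'[OF sequentially_bot] by blast
  have half: "\<bar>a N y $ i\<bar> \<le> 1 / 2" if y: "\<And>j. \<bar>y $ j\<bar> \<le> 1" for y i
  proof -
    have "a N y = a N (\<Sum>j\<in>UNIV. (y $ j) *\<^sub>R axis j 1)"
      using basis_expansion[of y] by (simp add: scalar_mult_eq_scaleR)
    also have "\<dots> = (\<Sum>j\<in>UNIV. (y $ j) *\<^sub>R a N (axis j 1))"
      by (simp add: linear_sum[OF lin] linear_cmul[OF lin])
    finally have "\<bar>a N y $ i\<bar> \<le> (\<Sum>j\<in>UNIV. \<bar>y $ j * a N (axis j 1) $ i\<bar>)" by simp
    also have "\<dots> \<le> (\<Sum>j\<in>(UNIV::'n set). 1 * \<epsilon>)"
      unfolding abs_mult by (intro sum_mono mult_mono y less_imp_le[OF N(1)]) auto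
    also have "\<dots> = 1 / 2" by (simp add: \<epsilon>_def)
    finally show ?thesis .
  qed
  \<comment> \<open>The bound 1/2 from \<open>half\<close> is to be the \<open>N\<close>-th power of
    the contraction rate; \<open>N \<ge> 1\<close> puts this root strictly below 1.\<close>
  define \<rho> where "\<rho> = root N (1 / 2)"
  have \<rho>: "0 < \<rho>" "\<rho> < 1" "\<rho> ^ N = 1 / 2" using N(2) by (simp_all add: \<rho>_def)
  \<comment> \<open>The adjoint turns the i-th component of A^k x into an inner product with a fixed
    vector, and the two signs encode the absolute value.\<close>
  define F where "F = (\<lambda>(k, i, \<sigma>). (\<sigma> / \<rho> ^ k) *\<^sub>R adjoint (a k) (axis i 1)) `
    ({..<N} \<times> (UNIV :: 'n set) \<times> {- 1, 1})"
  have "finite F" by (simp add: F_def)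
  then obtain P where P: "bij_betw P {1..card F} F" using ex_bij_betw_nat_finite_1 by blast
  have F: "((\<sigma> / \<rho> ^ k) *\<^sub>R adjoint (a k) (axis i 1)) \<bullet> x = \<sigma> * (a k x $ i) / \<rho> ^ k"
    for \<sigma> k i x
    using adjoint_works[OF lin, of x k "axis i 1"] by (simp add: inner_commute[of _ x] inner_axis)
  have "poly_set (card F) P = {x. \<forall>\<phi>\<in>P ` {1..card F}. \<phi> \<bullet> x \<le> 1}"
    by (simp add: poly_set_def)
  also have "\<dots> = {x. \<forall>\<phi>\<in>F. \<phi> \<bullet> x \<le> 1}"
    by (simp only: bij_betw_imp_surj_on[OF P])
  also have "\<dots> = {x. \<forall>k<N. \<forall>i. \<forall>\<sigma>\<in>{- 1, 1}. \<sigma> * (a k x $ i) / \<rho> ^ k \<le> 1}"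
    unfolding F_def by (auto simp: F simp del: inner_scaleR_left)
  also have "\<dots> = {x. \<forall>k<N. \<forall>i. \<bar>a k x $ i\<bar> \<le> \<rho> ^ k}"
    using \<rho>(1) by (auto simp: abs_le_iff divide_le_eq minus_le_iff)
  finally have S: "poly_set (card F) P = {x. \<forall>k<N. \<forall>i. \<bar>a k x $ i\<bar> \<le> \<rho> ^ k}" .
  \<comment> \<open>The condition for k = 0 confines x to the unit cube.\<close>
  have "norm x \<le> CARD('n)" if "x \<in> poly_set (card F) P" for x
  proof -
    have "\<bar>x $ i\<bar> \<le> 1" for i using that N(2) unfolding S by (force simp: a_def dest: spec[of _ 0])
    then have "(\<Sum>i\<in>UNIV. \<bar>x $ i\<bar>) \<le> (\<Sum>i\<in>(UNIV::'n set). 1)" by (intro sum_mono)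
    then show ?thesis using norm_le_l1_cart[of x] by simp
  qed
  then have "compact (poly_set (card F) P)"
    by (auto simp: compact_eq_bounded_closed closed_poly_set bounded_iff)
  moreover have "(\<lambda>x. A *v x) ` poly_set (card F) P \<subseteq> (\<lambda>x. \<rho> *\<^sub>R x) ` poly_set (card F) P"
  proof safe
    fix x assume x: "x \<in> poly_set (card F) P"
    \<comment> \<open>The k-th condition on A x is the next condition on x, relaxed by one factor
      \<open>\<rho>\<close>. For k = N - 1 that condition is not among the defining ones; it follows
      from the unit cube condition and \<open>half\<close>.\<close>
    have "\<bar>a (Suc k) x $ i\<bar> \<le> \<rho> ^ Suc k" if "k < N" for k i
    proof (cases "Suc k < N")
      case True then show ?thesis using x unfolding S by blast
    next
      case False
      then have "Suc k = N" using that by simp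
      moreover have "\<bar>x $ j\<bar> \<le> 1" for j
        using x N(2) unfolding S by (force simp: a_def dest: spec[of _ 0])
      ultimately show ?thesis using half[of x i] by (simp only: \<rho>(3))
    qed
    moreover have "a k ((1 / \<rho>) *\<^sub>R (A *v x)) = (1 / \<rho>) *\<^sub>R a (Suc k) x" for k
      by (simp only: linear_cmul[OF lin]) (simp add: a_def funpow_swap1)
    ultimately have "(1 / \<rho>) *\<^sub>R (A *v x) \<in> poly_set (card F) P"
      using \<rho> unfolding S by (auto simp: abs_mult divide_le_eq mult.commute)
    moreover have "A *v x = \<rho> *\<^sub>R ((1 / \<rho>) *\<^sub>R (A *v x))" using \<rho> by simp
    ultimately show "A *v x \<in> (\<lambda>x. \<rho> *\<^sub>R x) ` poly_set (card F) P" by blast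
  qed
  ultimately show ?thesis using \<rho> unfolding contractive_polytope_def by (metis less_imp_le)
qed

section \<open>The discrete Lyapunov equation\<close>

lemma inner_transpose_matrix: "x \<bullet> (transpose A *v y) = (A *v x) \<bullet> y"
  for A :: "real^'n^'m"
  by (metis dot_lmul_matrix matrix_vector_mul_assoc transpose_matrix_vector inner_commute)

lemma matrix_eq_vectorI: "(\<And>x. A *v x = B *v x) \<Longrightarrow> A = B" for A B :: "real^'n^'m"
  using matrix_eq by blast

lemma linear_minus_sandwich: "linear (\<lambda>X. X - B ** X ** C)" for B C :: "real^'n^'n"
proof (rule linearI; rule matrix_eq_vectorI)
  show "(X + Y - B ** (X + Y) ** C) *v z = (X - B ** X ** C + (Y - B ** Y ** C)) *v z" for X Y z
    by (simp add: matrix_vector_mult_add_rdistrib matrix_vector_mult_diff_rdistrib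
        matrix_vector_right_distrib flip: matrix_vector_mul_assoc)
  show "(c *\<^sub>R X - B ** (c *\<^sub>R X) ** C) *v z = (c *\<^sub>R (X - B ** X ** C)) *v z" for c X z
    by (simp add: matrix_vector_mult_diff_rdistrib matrix_vector_mult_scaleR scaleR_diff_right
       flip: matrix_vector_mul_assoc scaleR_matrix_vector_assoc)
qed

lemma schur_lyapunov_unique:
  fixes A M :: "real^'n^'n"
  assumes "schur A"
  shows "\<exists>!X. X = transpose A ** X ** A + M"
proof -
  let ?L = "\<lambda>X. X - transpose A ** X ** A"
  have "X = 0" if X: "X = transpose A ** X ** A" for X :: "real^'n^'n"
  proof -
    have step: "y \<bullet> (X *v z) = (A *v y) \<bullet> (X *v (A *v z))" for y z
      by (subst X) (simp only: matrix_vector_mul_assoc[symmetric] inner_transpose_matrix)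
    \<comment> \<open>The bilinear form of a homogeneous solution is constant along simultaneous
      iterates of y and z, while both iterates tend to 0.\<close>
    have "y \<bullet> (X *v z) = 0" for y z
    proof -
      have eq: "(((*v) A ^^ k) y) \<bullet> (X *v (((*v) A ^^ k) z)) = y \<bullet> (X *v z)" for k
        using step by (induction k) simp_all
      have "(\<lambda>k. (((*v) A ^^ k) y) \<bullet> (X *v (((*v) A ^^ k) z))) \<longlonglongrightarrow> 0 \<bullet> (X *v 0)"
        by (rule tendsto_inner[OF schur_funpow_tendsto_0[OF assms]
            bounded_linear.tendsto[OF matrix_vector_mul_bounded_linear
              schur_funpow_tendsto_0[OF assms]]])
      then show ?thesis unfolding eq by (simp add: LIMSEQ_const_iff)
    qed
    then have "X *v z = 0 *v z" for z using inner_eq_zero_iff[of "X *v z"] by simp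
    then show ?thesis by (rule matrix_eq_vectorI)
  qed
  then have "inj ?L"
    by (intro linear_injective_0[OF linear_minus_sandwich, THEN iffD2]) auto
  moreover from this have "surj ?L" by (rule linear_inj_imp_surj[OF linear_minus_sandwich])
  ultimately have "bij ?L" by (rule bijI)
  then have "\<exists>!X. ?L X = M" by (simp only: bij_iff)
  then show ?thesis by (simp only: diff_eq_eq add.commute)
qed

section \<open>The gauge of a compact polytope\<close>

lemma zero_in_poly_set: "0 \<in> poly_set r P"
  by (simp add: poly_set_def)

text \<open>The polytope is not assumed symmetric, so the gauges of y and -y may differ and this is
  not a norm in general.\<close>

definition poly_gauge :: "nat \<Rightarrow> (nat \<Rightarrow> real^'n) \<Rightarrow> real^'n \<Rightarrow> real" where
  "poly_gauge r P y = (MAX i\<in>{1..r}. P i \<bullet> y)"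

lemma V_delta_eq: "V_delta r P x z v = (poly_gauge r P (x - z))\<^sup>2"
  by (simp add: V_delta_def poly_gauge_def)

lemma poly_gauge_ge: "i \<in> {1..r} \<Longrightarrow> P i \<bullet> y \<le> poly_gauge r P y"
  by (simp add: poly_gauge_def)

lemma SUP_linear_upper:
  fixes h :: "'a::euclidean_space \<Rightarrow> real"
  assumes "compact S" "linear h" "x \<in> S"
  shows "h x \<le> (SUP y\<in>S. h y)"
proof -
  have "compact (h ` S)"
    using assms linear_continuous_on linear_conv_bounded_linear compact_continuous_image by blast
  then show ?thesis
    using assms(3) by (intro cSUP_upper) (simp_all add: bounded_imp_bdd_above compact_imp_bounded)
qed

text \<open>Used to contradict compactness when every defining functional is nonpositive in some
  direction.\<close>

lemma ray_unbounded:
  fixes y :: "'a::real_normed_vector"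
  assumes "bounded S" "y \<noteq> 0"
  obtains t where "0 < t" "t *\<^sub>R y \<notin> S"
proof -
  obtain b where b: "0 < b" "\<And>x. x \<in> S \<Longrightarrow> norm x \<le> b"
    using assms(1) bounded_pos by blast
  have "norm (((b + 1) / norm y) *\<^sub>R y) = b + 1" using assms(2) b(1) by simp
  then have "((b + 1) / norm y) *\<^sub>R y \<notin> S" using b(2) by fastforce
  moreover have "0 < (b + 1) / norm y" using assms(2) b(1) by simp
  ultimately show ?thesis using that by blast
qed

context
  fixes r :: nat and P :: "nat \<Rightarrow> real^'n"
  assumes compact: "compact (poly_set r P)"
begin

text \<open>Without inequalities the polytope would be the whole space, which is unbounded. This
  makes the maximum in the gauge range over a nonempty set.\<close>

lemma poly_set_index: "1 \<le> r"
proof (rule ccontr)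
  assume "\<not> 1 \<le> r"
  then have "poly_set r P = UNIV" by (simp add: poly_set_def)
  then show False using compact not_bounded_UNIV compact_imp_bounded by metis
qed

lemma poly_gauge_le_iff: "poly_gauge r P y \<le> c \<longleftrightarrow> (\<forall>i\<in>{1..r}. P i \<bullet> y \<le> c)"
  using poly_set_index by (simp add: poly_gauge_def)

lemma poly_gauge_zero [simp]: "poly_gauge r P 0 = 0"
  using poly_set_index by (simp add: poly_gauge_def)

text \<open>If all functionals were nonpositive at y, the whole ray through y would lie in the
  polytope.\<close>

lemma poly_gauge_pos:
  assumes "y \<noteq> 0"
  shows "0 < poly_gauge r P y"
proof (rule ccontr)
  assume "\<not> 0 < poly_gauge r P y"
  then have "P i \<bullet> y \<le> 0" if "i \<in> {1..r}" for i
    using poly_gauge_ge[OF that] by (meson not_less order_trans)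
  then have "t *\<^sub>R y \<in> poly_set r P" if "0 < t" for t
    using that by (fastforce simp: poly_set_def intro: order_trans[OF mult_nonneg_nonpos])
  then show False using ray_unbounded[OF compact_imp_bounded[OF compact] assms] by blast
qed

lemma poly_gauge_nonneg: "0 \<le> poly_gauge r P y"
  using poly_gauge_pos[of y] by (cases "y = 0") auto

lemma poly_gauge_le_scaled:
  assumes "poly_gauge r P y \<le> c"
  obtains x where "x \<in> poly_set r P" "y = c *\<^sub>R x"
\<comment> \<open>Radius 0 allows no division by c, but positivity of the gauge then forces y =
  0.\<close>
proof (cases "c = 0")
  case True
  then have "y = 0" using assms poly_gauge_pos[of y] by force
  then show ?thesis using that[OF zero_in_poly_set] by simp
next
  case False
  then have c: "0 < c" using assms poly_gauge_nonneg[of y] by simp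
  then have "(1 / c) *\<^sub>R y \<in> poly_set r P"
    using assms by (simp add: poly_set_def poly_gauge_le_iff)
  then show ?thesis using that[of "(1 / c) *\<^sub>R y"] c by simp
qed

text \<open>A vector of gauge at most c is c times a point of the polytope, so homogeneity reduces
  the bound to the maximum over the polytope. Both the tightening constants and \<open>L_w\<close>
  enter through this estimate.\<close>

lemma linear_le_SUP_poly_gauge:
  assumes "linear h" "poly_gauge r P y \<le> c"
  shows "h y \<le> (SUP x\<in>poly_set r P. h x) * c"
proof -
  obtain x where x: "x \<in> poly_set r P" "y = c *\<^sub>R x" using poly_gauge_le_scaled[OF assms(2)] .
  have "0 \<le> c" using assms(2) poly_gauge_nonneg[of y] by simp
  then show ?thesis
    using SUP_linear_upper[OF compact assms(1) x(1)] x(2)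
    by (simp add: linear_cmul[OF assms(1)] mult.commute mult_left_mono)
qed

lemma SUP_linear_nonneg:
  fixes h :: "real^'n \<Rightarrow> real"
  assumes "linear h"
  shows "0 \<le> (SUP x\<in>poly_set r P. h x)"
  using SUP_linear_upper[OF compact assms zero_in_poly_set] linear_0[OF assms] by simp

lemma poly_gauge_add: "poly_gauge r P (x + y) \<le> poly_gauge r P x + poly_gauge r P y"
  unfolding poly_gauge_le_iff inner_add_right by (intro ballI add_mono poly_gauge_ge)

lemma norm_le_poly_gauge: "\<exists>b>0. \<forall>y. norm y \<le> b * poly_gauge r P y"
proof -
  obtain b where b: "0 < b" "\<And>x. x \<in> poly_set r P \<Longrightarrow> norm x \<le> b"
    using compact_imp_bounded[OF compact] bounded_pos by blast
  have "norm y \<le> b * poly_gauge r P y" for y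
  proof -
    obtain x where x: "x \<in> poly_set r P" "y = poly_gauge r P y *\<^sub>R x"
      using poly_gauge_le_scaled[of y, OF order_refl] .
    have "norm y = poly_gauge r P y * norm x"
      by (subst x(2)) (simp add: poly_gauge_nonneg)
    then show ?thesis
      using b(2)[OF x(1)] poly_gauge_nonneg[of y] by (simp add: mult.commute[of _ "norm x"] mult_right_mono)
  qed
  then show ?thesis using b(1) by blast
qed

lemma poly_gauge_le_norm: "\<exists>b>0. \<forall>y. poly_gauge r P y \<le> b * norm y"
proof -
  \<comment> \<open>The summand 1 makes the constant positive at once.\<close>
  define b where "b = 1 + (\<Sum>i\<in>{1..r}. norm (P i))"
  have "P i \<bullet> y \<le> b * norm y" if "i \<in> {1..r}" for i y
  proof -
    have "norm (P i) \<le> (\<Sum>i\<in>{1..r}. norm (P i))" using that by (intro member_le_sum) auto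
    then have "norm (P i) * norm y \<le> b * norm y" by (intro mult_right_mono) (auto simp: b_def)
    then show ?thesis using norm_cauchy_schwarz[of "P i" y] by linarith
  qed
  moreover have "0 < b" by (simp add: b_def add_pos_nonneg sum_nonneg)
  ultimately show ?thesis unfolding poly_gauge_le_iff by blast
qed

text \<open>Homogeneity turns the set inclusion into an inequality for every vector.\<close>

lemma poly_gauge_contraction:
  assumes "contractive_polytope A r P \<rho>"
  shows "poly_gauge r P (A *v y) \<le> \<rho> * poly_gauge r P y"
proof -
  have \<rho>: "0 \<le> \<rho>" and sub: "(\<lambda>x. A *v x) ` poly_set r P \<subseteq> (\<lambda>x. \<rho> *\<^sub>R x) ` poly_set r P"
    using assms by (auto simp: contractive_polytope_def)
  obtain x where x: "x \<in> poly_set r P" "y = poly_gauge r P y *\<^sub>R x"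
    using poly_gauge_le_scaled[of y, OF order_refl] .
  then obtain x' where x': "x' \<in> poly_set r P" "A *v x = \<rho> *\<^sub>R x'" using sub by blast
  have "A *v y = (\<rho> * poly_gauge r P y) *\<^sub>R x'"
    by (subst x(2)) (simp add: matrix_vector_mult_scaleR x'(2) mult.commute)
  moreover have "P i \<bullet> x' \<le> 1" if "i \<in> {1..r}" for i using x'(1) that by (simp add: poly_set_def)
  ultimately show ?thesis
    using \<rho> poly_gauge_nonneg[of y] by (simp add: poly_gauge_le_iff mult_left_le)
qed

lemma continuous_on_poly_gauge: "continuous_on S (\<lambda>x. poly_gauge r P (x - z))"
proof -
  have "continuous_on S (\<lambda>x. Max ((\<lambda>i. P i \<bullet> (x - z)) ` I))" if "finite I" "I \<noteq> {}" for I
    using that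
  proof (induction rule: finite_ne_induct)
    case (singleton i) show ?case by (simp, intro continuous_intros)
  next
    case (insert i I)
    have "continuous_on S (\<lambda>x. max (P i \<bullet> (x - z)) (MAX i\<in>I. P i \<bullet> (x - z)))"
      by (intro continuous_on_max insert.IH continuous_intros)
    then show ?case using insert by simp
  qed
  from this[of "{1..r}"] show ?thesis using poly_set_index by (simp add: poly_gauge_def)
qed

text \<open>Nonnegativity of the gauge allows the squares to be dropped, so every hypothesis on
  \<open>V_delta\<close> becomes one on the gauge.\<close>

lemma V_delta_le_iff: "0 \<le> c \<Longrightarrow> V_delta r P x z v \<le> c\<^sup>2 \<longleftrightarrow> poly_gauge r P (x - z) \<le> c"
  using poly_gauge_nonneg[of "x - z"] by (simp add: V_delta_eq abs_le_square_iff[symmetric])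

lemma feedback_gauge_bound: "\<exists>b>0. \<forall>y. norm (K *v y) \<le> b * poly_gauge r P y"
  for K :: "real^'n^'m"
proof -
  obtain b where b: "0 < b" "\<And>y. norm y \<le> b * poly_gauge r P y" using norm_le_poly_gauge by blast
  obtain k where k: "0 < k" "\<And>y. norm (K *v y) \<le> norm y * k"
    using bounded_linear.pos_bounded[OF matrix_vector_mul_bounded_linear[of K]] by blast
  have "norm (K *v y) \<le> (b * k) * poly_gauge r P y" for y
    using k(2)[of y] mult_right_mono[OF b(2)[of y] less_imp_le[OF k(1)]] by (simp add: ac_simps)
  then show ?thesis using b(1) k(1) by (meson mult_pos_pos)
qed

end

section \<open>Constraint tightening\<close>

lemma tightening_bound:
  assumes "compact (poly_set r P)" "poly_gauge r P y \<le> c"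
  shows "Lx j \<bullet> y + Lu j \<bullet> (K *v y) \<le> tightening Lx Lu K r P j * c"
  unfolding tightening_def
  by (rule linear_le_SUP_poly_gauge[OF assms(1) _ assms(2)])
    (auto intro!: linearI simp: algebra_simps)

lemma zero_in_constr_set: "(0, 0) \<in> constr_set p Lx Lu"
  by (simp add: constr_set_def constr_def)

lemma constr_set_positive:
  assumes "compact (constr_set p Lx Lu)" "(x, u) \<noteq> (0, 0)"
  shows "\<exists>j\<in>{1..p}. 0 < Lx j \<bullet> x + Lu j \<bullet> u"
proof (rule ccontr)
  assume "\<not> ?thesis"
  then have "t * (Lx j \<bullet> x + Lu j \<bullet> u) \<le> 0" if "0 < t" "j \<in> {1..p}" for t j
    using that by (meson not_less mult_nonneg_nonpos less_imp_le)
  then have "t *\<^sub>R (x, u) \<in> constr_set p Lx Lu" if "0 < t" for t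
    using that by (fastforce simp: constr_set_def constr_def distrib_left)
  then show False
    using ray_unbounded[OF compact_imp_bounded[OF assms(1)], of "(x, u)"] assms(2)
    by (metis zero_prod_def)
qed

text \<open>The terminal set divides by this maximum. At (y, K y) with y nonzero, compactness of the
  constraint set makes some constraint functional positive, and \<open>tightening_bound\<close>
  passes the sign to its constant.\<close>

lemma Max_tightening_pos:
  fixes K :: "real^'n^'m"
  assumes "compact (constr_set p Lx Lu)" "compact (poly_set r P)"
  shows "0 < (MAX j\<in>{1..p}. tightening Lx Lu K r P j)"
proof -
  obtain y :: "real^'n" where y: "y \<noteq> 0" using zero_neq_one by blast
  then have "(y, K *v y) \<noteq> (0, 0)" by simp
  then obtain j where j: "j \<in> {1..p}" "0 < Lx j \<bullet> y + Lu j \<bullet> (K *v y)"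
    using constr_set_positive[OF assms(1)] by blast
  moreover have "Lx j \<bullet> y + Lu j \<bullet> (K *v y) \<le> tightening Lx Lu K r P j * poly_gauge r P y"
    by (rule tightening_bound[OF assms(2) order_refl])
  ultimately have "0 < tightening Lx Lu K r P j"
    using poly_gauge_pos[OF assms(2) y] by (smt (verit) zero_less_mult_pos2)
  also have "\<dots> \<le> (MAX j\<in>{1..p}. tightening Lx Lu K r P j)" using j(1) by simp
  finally show ?thesis .
qed

section \<open>Parameter vertices and disturbance bounds\<close>

lemma linear_lin_param: "linear (\<lambda>\<theta>. lin_param M \<theta> *v z)"
proof (rule linearI)
  show "lin_param M (a + b) *v z = lin_param M a *v z + lin_param M b *v z" for a b
    by (simp add: lin_param_def scaleR_add_left sum.distrib matrix_vector_mult_add_rdistrib)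
  have "lin_param M (c *\<^sub>R a) = c *\<^sub>R lin_param M a" for c a
    by (simp add: lin_param_def scaleR_sum_right)
  then show "lin_param M (c *\<^sub>R a) *v z = c *\<^sub>R (lin_param M a *v z)" for c a
    by (simp only: scaleR_matrix_vector_assoc)
qed

lemma polytope_vertices:
  fixes \<Theta> :: "'a::euclidean_space set"
  assumes "polytope \<Theta>" "\<Theta> \<noteq> {}"
  shows "finite (vertices \<Theta>)" "vertices \<Theta> \<noteq> {}" "\<Theta> = convex hull (vertices \<Theta>)"
proof -
  show "finite (vertices \<Theta>)"
    unfolding vertices_def using assms(1)
    by (intro finite_polyhedron_extreme_points polytope_imp_polyhedron)
  show hull: "\<Theta> = convex hull (vertices \<Theta>)"
    unfolding vertices_def using assms(1)
    by (intro Krein_Milman_Minkowski polytope_imp_compact polytope_imp_convex)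
  then show "vertices \<Theta> \<noteq> {}" using assms(2) by auto
qed

text \<open>A linear function is convex, and a convex function on the hull of the vertices is
  bounded by its maximum over them. Hence the vertex maximum in \<open>w_tilde\<close> covers all
  parameters.\<close>

lemma linear_le_at_vertex:
  fixes \<Theta> :: "'a::euclidean_space set"
  assumes "polytope \<Theta>" "linear h" "\<theta> \<in> \<Theta>"
  shows "\<exists>\<theta>'\<in>vertices \<Theta>. h \<theta> \<le> (h \<theta>' :: real)"
proof -
  have ne: "\<Theta> \<noteq> {}" using assms(3) by blast
  note fin = polytope_vertices(1)[OF assms(1) ne] and vne = polytope_vertices(2)[OF assms(1) ne]
  have "convex_on (convex hull (vertices \<Theta>)) h"
    using assms(2) by (simp add: convex_on_def convex_convex_hull linear_add linear_cmul)
  then have "h \<theta> \<le> Max (h ` vertices \<Theta>)"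
    using convex_on_convex_hull_bound[of "vertices \<Theta>" h "Max (h ` vertices \<Theta>)"] fin assms(3)
      polytope_vertices(3)[OF assms(1) ne] by auto
  moreover have "Max (h ` vertices \<Theta>) \<in> h ` vertices \<Theta>" using fin vne by (intro Max_in) auto
  ultimately show ?thesis by auto
qed

lemma linear_inner_matrix: "linear (\<lambda>x. a \<bullet> (M *v x))" for M :: "real^'n^'m"
  by (rule linearI) (simp_all add: algebra_simps)

lemma d_bar_ge:
  fixes E :: "real^'d^'n"
  assumes "polytope D" "d \<in> D"
  shows "P i \<bullet> (E *v d) \<le> d_bar E D P i"
  unfolding d_bar_def
  by (rule SUP_linear_upper[OF polytope_imp_compact[OF assms(1)] linear_inner_matrix assms(2)])

context
  fixes A :: "'q::finite \<Rightarrow> real^'n^'n" and B :: "'q \<Rightarrow> real^'m^'n"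
    and E :: "real^'d^'n" and \<Theta> :: "(real^'q) set" and D :: "(real^'d) set"
    and K :: "real^'n^'m" and r :: nat and P :: "nat \<Rightarrow> real^'n"
  assumes \<Theta>: "polytope \<Theta>" "\<Theta> \<noteq> {}" and compact: "compact (poly_set r P)"
begin

lemma w_tilde_ge:
  assumes "i \<in> {1..r}" "\<theta> \<in> vertices \<Theta>"
  shows "P i \<bullet> (lin_param A \<theta> *v z + lin_param B \<theta> *v v) + d_bar E D P i
    \<le> w_tilde A B E \<Theta> D r P z v"
  unfolding w_tilde_def
  using assms polytope_vertices(1)[OF \<Theta>] by (intro Max_ge) (auto intro: image_eqI[of _ _ "(i, \<theta>)"])

lemma w_tilde_le:
  assumes "\<And>i \<theta>. i \<in> {1..r} \<Longrightarrow> \<theta> \<in> vertices \<Theta> \<Longrightarrow>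
    P i \<bullet> (lin_param A \<theta> *v z + lin_param B \<theta> *v v) + d_bar E D P i \<le> c"
  shows "w_tilde A B E \<Theta> D r P z v \<le> c"
  unfolding w_tilde_def
  using assms polytope_vertices[OF \<Theta>] poly_set_index[OF compact] by (subst Max_le_iff) auto

lemma L_w_ge:
  assumes "i \<in> {1..r}" "\<theta> \<in> vertices \<Theta>"
  shows "(SUP dx\<in>poly_set r P. P i \<bullet> ((lin_param A \<theta> + lin_param B \<theta> ** K) *v dx))
    \<le> L_w A B \<Theta> K r P"
  unfolding L_w_def
  using assms polytope_vertices(1)[OF \<Theta>] by (intro Max_ge) (auto intro: image_eqI[of _ _ "(i, \<theta>)"])

lemma L_w_nonneg: "0 \<le> L_w A B \<Theta> K r P"
proof -
  obtain \<theta> where "\<theta> \<in> vertices \<Theta>" using polytope_vertices(2)[OF \<Theta>] by blast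
  moreover have "1 \<in> {1..r}" using poly_set_index[OF compact] by simp
  ultimately show ?thesis
    using L_w_ge SUP_linear_nonneg[OF compact linear_inner_matrix] order_trans by blast
qed

text \<open>Passing from (z, v) to x under the feedback adds the closed-loop parametric matrix
  applied to x - z, which \<open>L_w\<close> bounds per unit of gauge. Both properties of
  \<open>w_delta\<close> rest on this, and so does the terminal step, where z and v are 0.\<close>

lemma w_tilde_shift:
  assumes "poly_gauge r P (x - z) \<le> c"
  shows "w_tilde A B E \<Theta> D r P x (feedback K x z v)
    \<le> w_tilde A B E \<Theta> D r P z v + L_w A B \<Theta> K r P * c"
proof (rule w_tilde_le)
  fix i \<theta> assume i: "i \<in> {1..r}" and \<theta>: "\<theta> \<in> vertices \<Theta>"
  let ?M = "lin_param A \<theta> + lin_param B \<theta> ** K"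
  have "0 \<le> c" using assms poly_gauge_nonneg[OF compact, of "x - z"] by linarith
  have "P i \<bullet> (?M *v (x - z)) \<le> (SUP dx\<in>poly_set r P. P i \<bullet> (?M *v dx)) * c"
    by (rule linear_le_SUP_poly_gauge[OF compact linear_inner_matrix assms])
  also have "\<dots> \<le> L_w A B \<Theta> K r P * c"
    using L_w_ge[OF i \<theta>] \<open>0 \<le> c\<close> by (rule mult_right_mono)
  finally have "P i \<bullet> (?M *v (x - z)) \<le> L_w A B \<Theta> K r P * c" .
  moreover have "lin_param A \<theta> *v x + lin_param B \<theta> *v feedback K x z v
      = (lin_param A \<theta> *v z + lin_param B \<theta> *v v) + ?M *v (x - z)"
    by (simp add: feedback_def matrix_vector_mul_assoc[symmetric] algebra_simps)
  ultimately show "P i \<bullet> (lin_param A \<theta> *v x + lin_param B \<theta> *v feedback K x z v) + d_bar E D P i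
      \<le> w_tilde A B E \<Theta> D r P z v + L_w A B \<Theta> K r P * c"
    using w_tilde_ge[OF i \<theta>, of z v] by (simp add: inner_add_right)
qed

text \<open>The two uncertainties are maximised separately: the parametric part at a vertex, the
  additive part by \<open>d_bar\<close>.\<close>

lemma disturbance_gauge_le:
  assumes "polytope D" "d\<^sub>w \<in> disturbance_set A B E \<Theta> D x u"
  shows "poly_gauge r P d\<^sub>w \<le> w_tilde A B E \<Theta> D r P x u"
  unfolding poly_gauge_le_iff[OF compact]
proof
  fix i assume i: "i \<in> {1..r}"
  obtain \<theta> d where d: "\<theta> \<in> \<Theta>" "d \<in> D"
      "d\<^sub>w = lin_param A \<theta> *v x + lin_param B \<theta> *v u + E *v d"
    using assms(2) by (auto simp: disturbance_set_def)
  let ?h = "\<lambda>\<theta>. P i \<bullet> (lin_param A \<theta> *v x + lin_param B \<theta> *v u)"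
  have "linear ?h"
    by (rule linearI) (simp_all add: linear_add[OF linear_lin_param] linear_cmul[OF linear_lin_param]
        inner_add_right distrib_left)
  then obtain \<theta>' where "\<theta>' \<in> vertices \<Theta>" "?h \<theta> \<le> ?h \<theta>'"
    using linear_le_at_vertex[OF \<Theta>(1) _ d(1)] by blast
  then show "P i \<bullet> d\<^sub>w \<le> w_tilde A B E \<Theta> D r P x u"
    using w_tilde_ge[OF i, of \<theta>' x u] d_bar_ge[OF assms(1) d(2), of P i E]
    by (simp add: d(3) inner_add_right)
qed

text \<open>The individual terms of the maximum may be negative, but the maximum dominates the gauge
  of an actual disturbance.\<close>

lemma w_tilde_nonneg:
  assumes "polytope D" "D \<noteq> {}"
  shows "0 \<le> w_tilde A B E \<Theta> D r P z v"
proof -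
  obtain d\<^sub>w where "d\<^sub>w \<in> disturbance_set A B E \<Theta> D z v"
    using \<Theta>(2) assms(2) by (auto simp: disturbance_set_def)
  then show ?thesis
    using disturbance_gauge_le[OF assms(1)] poly_gauge_nonneg[OF compact] order_trans by blast
qed

lemma w_tilde_origin: "w_tilde A B E \<Theta> D r P 0 0 \<le> (MAX i\<in>{1..r}. d_bar E D P i)"
  by (rule w_tilde_le) simp

end

section \<open>Terminal cost and closed-loop identities\<close>

lemma quadratic_form_lipschitz:
  fixes M :: "real^'n^'n"
  assumes "bounded S"
  obtains C where "0 < C" "\<And>x z. x \<in> S \<Longrightarrow> z \<in> S \<Longrightarrow> z \<bullet> (M *v z) \<le> x \<bullet> (M *v x) + C * norm (x - z)"
proof -
  obtain b where b: "0 < b" "\<And>x. x \<in> S \<Longrightarrow> norm x \<le> b"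
    using assms bounded_pos by blast
  obtain k where k: "0 < k" "\<And>y. norm (M *v y) \<le> norm y * k"
    using bounded_linear.pos_bounded[OF matrix_vector_mul_bounded_linear[of M]] by blast
  show ?thesis
  proof (rule that[of "2 * b * k"])
    show "0 < 2 * b * k" using b k by simp
    fix x z assume S: "x \<in> S" "z \<in> S"
    \<comment> \<open>Each summand contains z - x once; the other factors are bounded on
      \<open>S\<close>, giving \<open>b * k\<close> for each half.\<close>
    have "z \<bullet> (M *v z) - x \<bullet> (M *v x) = (z - x) \<bullet> (M *v z) + x \<bullet> (M *v (z - x))"
      by (simp add: algebra_simps)
    also have "\<dots> \<le> norm (z - x) * norm (M *v z) + norm x * norm (M *v (z - x))"
      by (intro add_mono norm_cauchy_schwarz)
    also have "\<dots> \<le> norm (z - x) * (b * k) + b * (norm (z - x) * k)"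
      using S b k(1)
      by (intro add_mono mult_left_mono mult_mono order_trans[OF k(2)] mult_right_mono) auto
    finally show "z \<bullet> (M *v z) \<le> x \<bullet> (M *v x) + 2 * b * k * norm (x - z)"
      by (simp add: norm_minus_commute algebra_simps)
  qed
qed

lemma class_K_inf_linear:
  assumes "0 < C"
  shows "class_K_inf (\<lambda>t. C * t)"
proof -
  have "\<not> bdd_above ((\<lambda>t. C * t) ` {0..})"
  proof
    assume "bdd_above ((\<lambda>t. C * t) ` {0..})"
    then obtain b where b: "\<And>t. 0 \<le> t \<Longrightarrow> C * t \<le> b" by (auto simp: bdd_above_def)
    have "C * ((\<bar>b\<bar> + 1) / C) \<le> b" using assms by (intro b) simp
    then show False using assms by simp
  qed
  then show ?thesis
    using assms by (auto simp: class_K_inf_def strict_mono_on_def intro!: continuous_intros)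
qed

lemma nominal_closed_loop: "nominal A\<^sub>0 B\<^sub>0 x (K *v x) = (A\<^sub>0 + B\<^sub>0 ** K) *v x"
  by (simp add: nominal_def matrix_vector_mul_assoc matrix_vector_mult_add_rdistrib)

lemma nominal_feedback_diff:
  "nominal A\<^sub>0 B\<^sub>0 x (feedback K x z v) - nominal A\<^sub>0 B\<^sub>0 z v = (A\<^sub>0 + B\<^sub>0 ** K) *v (x - z)"
  by (simp add: nominal_def feedback_def matrix_vector_mul_assoc[symmetric] algebra_simps)

lemma constr_feedback_diff:
  "constr Lx Lu j x (feedback K x z v) - constr Lx Lu j z v
    = Lx j \<bullet> (x - z) + Lu j \<bullet> (K *v (x - z))"
  by (simp add: constr_def feedback_def algebra_simps)

text \<open>Reading the Lyapunov equation as a quadratic form at x gives the decrease of the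
  terminal cost with equality.\<close>

lemma lyapunov_decrease:
  fixes A Q P\<^sub>f :: "real^'n^'n" and R :: "real^'m^'m" and K :: "real^'n^'m"
  assumes "P\<^sub>f = transpose A ** P\<^sub>f ** A + Q + transpose K ** R ** K"
  shows "(A *v x) \<bullet> (P\<^sub>f *v (A *v x)) = x \<bullet> (P\<^sub>f *v x) - stage_cost Q R x (K *v x)"
proof -
  have "x \<bullet> (P\<^sub>f *v x) = x \<bullet> ((transpose A ** P\<^sub>f ** A + Q + transpose K ** R ** K) *v x)"
    using assms by simp
  also have "\<dots> = (A *v x) \<bullet> (P\<^sub>f *v (A *v x)) + stage_cost Q R x (K *v x)"
    by (simp only: matrix_vector_mult_add_rdistrib inner_add_right matrix_vector_mul_assoc[symmetric]
        inner_transpose_matrix stage_cost_def)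
  finally show ?thesis by simp
qed

text \<open>Moving s to the right-hand side merges all inequalities into one for the gauge.\<close>

lemma terminal_set_iff_gauge:
  assumes "compact (poly_set r P)"
  shows "(x, s) \<in> terminal_set r P c \<longleftrightarrow> 0 \<le> s \<and> poly_gauge r P x + s \<le> 1 / c"
proof -
  have "P i \<bullet> x + s \<le> 1 / c \<longleftrightarrow> P i \<bullet> x \<le> 1 / c - s" for i by linarith
  then have "(\<forall>i\<in>{1..r}. P i \<bullet> x + s \<le> 1 / c) \<longleftrightarrow> poly_gauge r P x \<le> 1 / c - s"
    by (simp add: poly_gauge_le_iff[OF assms])
  then show ?thesis unfolding terminal_set_def by auto
qed

section \<open>Incremental stabilizability and terminal ingredients\<close>

theorem proposition5:
  fixes A\<^sub>0 :: "real^'n^'n" and B\<^sub>0 :: "real^'m^'n"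
    and A :: "'q::finite \<Rightarrow> real^'n^'n" and B :: "'q \<Rightarrow> real^'m^'n"
    and E :: "real^'d^'n"
    and \<Theta> :: "(real^'q) set" and D :: "(real^'d) set"
    and p :: nat and Lx :: "nat \<Rightarrow> real^'n" and Lu :: "nat \<Rightarrow> real^'m"
    and Q :: "real^'n^'n" and R :: "real^'m^'m"
    and K :: "real^'n^'m"
  assumes "polytope \<Theta>" and "\<Theta> \<noteq> {}"
    and "polytope D" and "D \<noteq> {}"
    and "compact (constr_set p Lx Lu)"
    and "positive_definite Q" and "positive_definite R"
    and "stabilizable A\<^sub>0 B\<^sub>0" and "schur (A\<^sub>0 + B\<^sub>0 ** K)"
  shows
    "let A\<^sub>K = A\<^sub>0 + B\<^sub>0 ** K;
         Z = constr_set p Lx Lu;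
         f = nominal A\<^sub>0 B\<^sub>0;
         g = constr Lx Lu;
         \<kappa> = feedback K;
         W = disturbance_set A B E \<Theta> D;
         lyap = (\<lambda>P\<^sub>f. P\<^sub>f = transpose A\<^sub>K ** P\<^sub>f ** A\<^sub>K + Q + transpose K ** R ** K)
     in
      (\<exists>r P \<rho>. contractive_polytope A\<^sub>K r P \<rho>) \<and>
      (\<exists>!P\<^sub>f. lyap P\<^sub>f) \<and>
      (\<forall>r P \<rho>. contractive_polytope A\<^sub>K r P \<rho> \<longrightarrow>
        (let V = V_delta r P;
             c = tightening Lx Lu K r P;
             w\<^sub>\<delta> = w_delta A B E \<Theta> D K r P
         in
          (\<forall>x z v. (z, v) \<in> Z \<longrightarrow>
             0 \<le> V x z v \<and> sqrt (V x z v) = (MAX i\<in>{1..r}. P i \<bullet> (x - z))) \<and>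
          (\<forall>z v. (z, v) \<in> Z \<longrightarrow> continuous_on UNIV (\<lambda>x. V x z v) \<and> V z z v = 0) \<and>
          (\<exists>c_l>0. \<exists>c_u>0. \<exists>\<kappa>_max>0. \<forall>\<delta>_loc>0. \<forall>x z v x' z' v'.
             (z, v) \<in> Z \<longrightarrow> V x z v \<le> \<delta>_loc \<longrightarrow>
             (z', v') \<in> Z \<longrightarrow> x' = f x (\<kappa> x z v) \<longrightarrow> z' = f z v \<longrightarrow>
               c_l * (norm (x - z))\<^sup>2 \<le> V x z v \<and>
               V x z v \<le> c_u * (norm (x - z))\<^sup>2 \<and>
               (norm (\<kappa> x z v - v))\<^sup>2 \<le> \<kappa>_max * V x z v \<and>
               V x' z' v' \<le> \<rho>\<^sup>2 * V x z v) \<and>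
          (\<forall>\<delta>_loc>0. \<forall>j\<in>{1..p}. \<forall>x z v. \<forall>\<gamma>\<in>{0..sqrt \<delta>_loc}.
             (z, v) \<in> Z \<longrightarrow> V x z v \<le> \<gamma>\<^sup>2 \<longrightarrow>
               g j x (\<kappa> x z v) - g j z v \<le> c j * \<gamma>) \<and>
          (\<forall>z v. \<forall>\<gamma>\<ge>0. 0 \<le> w\<^sub>\<delta> z v \<gamma>) \<and>
          (\<forall>\<delta>_loc>0. \<forall>\<gamma>\<in>{0..sqrt \<delta>_loc}. \<forall>x z v z' v'. \<forall>d\<^sub>w \<in> W x (\<kappa> x z v).
             (z, v) \<in> Z \<longrightarrow> V x z v \<le> \<gamma>\<^sup>2 \<longrightarrow> (z', v') \<in> Z \<longrightarrow> z' = f z v \<longrightarrow>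
               V (z' + d\<^sub>w) z' v' \<le> (w\<^sub>\<delta> z v \<gamma>)\<^sup>2) \<and>
          (\<forall>\<delta>_loc>0. \<forall>c\<^sub>1 c\<^sub>2 x z v.
             0 \<le> c\<^sub>2 \<longrightarrow> c\<^sub>2 \<le> c\<^sub>1 \<longrightarrow> c\<^sub>1 \<le> sqrt \<delta>_loc \<longrightarrow>
             (z, v) \<in> Z \<longrightarrow> V x z v \<le> (c\<^sub>1 - c\<^sub>2)\<^sup>2 \<longrightarrow>
               w\<^sub>\<delta> x (\<kappa> x z v) c\<^sub>2 \<le> w\<^sub>\<delta> z v c\<^sub>1) \<and>
          (let c_max = (MAX j\<in>{1..p}. c j);
               d_max = (MAX i\<in>{1..r}. d_bar E D P i);
               w_min = (INF (x, u)\<in>Z. w\<^sub>\<delta> x u 0);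
               w_max = (\<infinity> :: ereal);
               s_max = (\<infinity> :: ereal);
               k\<^sub>f = (\<lambda>x. K *v x);
               X\<^sub>f = terminal_set r P c_max;
               X\<^sub>f\<^sub>x = {x. \<exists>s. 0 \<le> s \<and> ereal s \<le> s_max \<and> (x, s) \<in> X\<^sub>f}
           in
            \<rho> + L_w A B \<Theta> K r P + c_max * d_max \<le> 1 \<longrightarrow>
            (\<forall>P\<^sub>f. lyap P\<^sub>f \<longrightarrow>
              (let V\<^sub>f = (\<lambda>x. x \<bullet> (P\<^sub>f *v x))
               in
                (\<forall>N :: nat. \<forall>x s w s' x' d\<^sub>w.
                   (x, s) \<in> X\<^sub>f \<longrightarrow>
                   w_min \<le> w \<longrightarrow> ereal w \<le> w_max \<longrightarrow>
                   s' \<in> {0..\<rho> * s - \<rho> ^ N * w + w\<^sub>\<delta> x (k\<^sub>f x) s} \<longrightarrow>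
                   x' = f x (k\<^sub>f x) \<longrightarrow>
                   V (x' + d\<^sub>w) x' (k\<^sub>f x') \<le> \<rho> ^ (2 * N) * w\<^sup>2 \<longrightarrow>
                     V\<^sub>f x' \<le> V\<^sub>f x - stage_cost Q R x (k\<^sub>f x) \<and>
                     (x' + d\<^sub>w, s') \<in> X\<^sub>f \<and>
                     ereal (w\<^sub>\<delta> x (k\<^sub>f x) s) \<le> w_max \<and>
                     (\<forall>j\<in>{1..p}. g j x (k\<^sub>f x) + c j * s \<le> 0) \<and>
                     ereal s \<le> s_max) \<and>
                compact X\<^sub>f\<^sub>x \<and>
                (\<exists>\<alpha>\<^sub>f. class_K_inf \<alpha>\<^sub>f \<and>
                   (\<forall>x\<in>X\<^sub>f\<^sub>x. \<forall>z\<in>X\<^sub>f\<^sub>x. V\<^sub>f z \<le> V\<^sub>f x + \<alpha>\<^sub>f (norm (x - z)))))))))"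
proof -
  let ?A = "A\<^sub>0 + B\<^sub>0 ** K" and ?Z = "constr_set p Lx Lu"
  have lyap: "\<exists>!P\<^sub>f. P\<^sub>f = transpose ?A ** P\<^sub>f ** ?A + Q + transpose K ** R ** K"
    using schur_lyapunov_unique[OF \<open>schur ?A\<close>, of "Q + transpose K ** R ** K"]
    by (simp only: add.assoc)
  show ?thesis
    unfolding Let_def
  proof (rule conjI[OF schur_imp_contractive_polytope[OF \<open>schur ?A\<close>] conjI[OF lyap]],
      intro allI impI, goal_cases)
    case cp: (1 r P \<rho>)
    then have compact: "compact (poly_set r P)" and \<rho>: "0 \<le> \<rho>" "\<rho> < 1"
      by (auto simp: contractive_polytope_def)
    let ?G = "poly_gauge r P" and ?c = "tightening Lx Lu K r P"
    let ?w = "w_tilde A B E \<Theta> D r P" and ?L = "L_w A B \<Theta> K r P"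
    note nonneg = poly_gauge_nonneg[OF compact]
    note V_le = V_delta_le_iff[OF compact]
    note w_nonneg = w_tilde_nonneg[OF assms(1,2) compact assms(3,4), of A B E]
    note w_shift = w_tilde_shift[OF assms(1,2) compact, where A = A and B = B and E = E and D = D and K = K]
    note L_nonneg = L_w_nonneg[OF assms(1,2) compact, of A B K]
    have contract: "?G (?A *v y) \<le> \<rho> * ?G y" for y
      by (rule poly_gauge_contraction[OF compact cp])
    show ?case
    proof (intro conjI, goal_cases)
      case 1
      show ?case using nonneg by (simp add: V_delta_eq) (simp add: poly_gauge_def)
    next
      case 2
      show ?case
        by (auto simp: V_delta_eq poly_gauge_zero[OF compact]
            intro!: continuous_intros continuous_on_poly_gauge[OF compact])
    next
      case 3
      obtain b where b: "0 < b" "\<And>y. norm y \<le> b * ?G y"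
        using norm_le_poly_gauge[OF compact] by blast
      obtain b' where b': "0 < b'" "\<And>y. ?G y \<le> b' * norm y"
        using poly_gauge_le_norm[OF compact] by blast
      obtain k where k: "0 < k" "\<And>y. norm (K *v y) \<le> k * ?G y"
        using feedback_gauge_bound[OF compact] by blast
      \<comment> \<open>The bounds are squares of gauge estimates valid for all vectors. The
        constants are therefore independent of \<open>\<delta>_loc\<close>, which can be arbitrarily
        large.\<close>
      have bounds: "1 / b\<^sup>2 * (norm (x - z))\<^sup>2 \<le> V_delta r P x z v"
        "V_delta r P x z v \<le> b'\<^sup>2 * (norm (x - z))\<^sup>2"
        "(norm (feedback K x z v - v))\<^sup>2 \<le> k\<^sup>2 * V_delta r P x z v"
        "V_delta r P (nominal A\<^sub>0 B\<^sub>0 x (feedback K x z v)) (nominal A\<^sub>0 B\<^sub>0 z v) v'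
          \<le> \<rho>\<^sup>2 * V_delta r P x z v" for x z :: "real^'n" and v v' :: "real^'m"
      proof -
        show "1 / b\<^sup>2 * (norm (x - z))\<^sup>2 \<le> V_delta r P x z v"
          using power_mono[OF b(2)[of "x - z"], of 2] b(1)
          by (simp add: V_delta_eq divide_le_eq power_mult_distrib mult.commute)
        show "V_delta r P x z v \<le> b'\<^sup>2 * (norm (x - z))\<^sup>2"
          using power_mono[OF b'(2)[of "x - z"] nonneg, of 2]
          by (simp add: V_delta_eq power_mult_distrib)
        show "(norm (feedback K x z v - v))\<^sup>2 \<le> k\<^sup>2 * V_delta r P x z v"
          using power_mono[OF k(2)[of "x - z"], of 2]
          by (simp add: V_delta_eq feedback_def power_mult_distrib)
        show "V_delta r P (nominal A\<^sub>0 B\<^sub>0 x (feedback K x z v)) (nominal A\<^sub>0 B\<^sub>0 z v) v'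
          \<le> \<rho>\<^sup>2 * V_delta r P x z v"
          using power_mono[OF contract[of "x - z"] nonneg, of 2]
          by (simp add: V_delta_eq nominal_feedback_diff power_mult_distrib)
      qed
      have pos: "0 < 1 / b\<^sup>2" "0 < b'\<^sup>2" "0 < k\<^sup>2" using b(1) b'(1) k(1) by simp_all
      show ?case
        by (rule exI[of _ "1 / b\<^sup>2"], rule conjI[OF pos(1)], rule exI[of _ "b'\<^sup>2"],
            rule conjI[OF pos(2)], rule exI[of _ "k\<^sup>2"], rule conjI[OF pos(3)],
            intro allI impI, hypsubst, intro conjI bounds)
    next
      case 4
      show ?case
        by (auto simp: V_le constr_feedback_diff intro: tightening_bound[OF compact])
    next
      case 5
      show ?case using w_nonneg L_nonneg by (simp add: w_delta_def)
    next
      case 6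
      show ?case
      proof (intro allI impI ballI)
        fix \<delta> \<gamma> :: real and x z z' d\<^sub>w :: "real^'n" and v v' :: "real^'m"
        assume \<gamma>: "\<gamma> \<in> {0..sqrt \<delta>}" and d: "d\<^sub>w \<in> disturbance_set A B E \<Theta> D x (feedback K x z v)"
          and V: "V_delta r P x z v \<le> \<gamma>\<^sup>2"
        \<comment> \<open>The nominal successor cancels in the difference, so only the gauge of the
          disturbance remains to be bounded.\<close>
        have "?G d\<^sub>w \<le> ?w x (feedback K x z v)"
          by (rule disturbance_gauge_le[OF assms(1,2) compact assms(3) d])
        also have "\<dots> \<le> w_delta A B E \<Theta> D K r P z v \<gamma>"
          using w_shift V \<gamma> by (simp add: w_delta_def V_le)
        finally show "V_delta r P (z' + d\<^sub>w) z' v' \<le> (w_delta A B E \<Theta> D K r P z v \<gamma>)\<^sup>2"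
          using nonneg by (simp add: V_delta_eq power_mono)
      qed
    next
      case 7
      show ?case
      proof (intro allI impI)
        fix \<delta> c\<^sub>1 c\<^sub>2 :: real and x z :: "real^'n" and v :: "real^'m"
        assume "c\<^sub>2 \<le> c\<^sub>1" "V_delta r P x z v \<le> (c\<^sub>1 - c\<^sub>2)\<^sup>2"
        then show "w_delta A B E \<Theta> D K r P x (feedback K x z v) c\<^sub>2 \<le> w_delta A B E \<Theta> D K r P z v c\<^sub>1"
          \<comment> \<open>Shifting by radius \<open>c\<^sub>1 - c\<^sub>2\<close> costs
            \<open>L_w\<close> times that difference; the term with \<open>c\<^sub>2\<close>
            completes it to \<open>c\<^sub>1\<close>.\<close>
          using w_shift[of x z "c\<^sub>1 - c\<^sub>2" v] by (simp add: w_delta_def V_le algebra_simps)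
      qed
    next
      case 8
      define c_max where "c_max = (MAX j\<in>{1..p}. ?c j)"
      define d_max where "d_max = (MAX i\<in>{1..r}. d_bar E D P i)"
      have c_max: "0 < c_max"
        unfolding c_max_def by (rule Max_tightening_pos[OF \<open>compact ?Z\<close> compact])
      note terminal_iff = terminal_set_iff_gauge[OF compact]
      let ?X = "{x. \<exists>s\<ge>0. (x, s) \<in> terminal_set r P c_max}"
      \<comment> \<open>The choice s = 0 is the least restrictive, so the projection is a sublevel
        set of the gauge, shown next to be a scaled copy of the polytope.\<close>
      have X: "?X = {x. ?G x \<le> 1 / c_max}"
        unfolding terminal_iff by (auto intro: exI[of _ 0])
      have "?X = (\<lambda>x. (1 / c_max) *\<^sub>R x) ` poly_set r P"
      proof (intro equalityI subsetI)
        fix x assume "x \<in> ?X"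
        then show "x \<in> (\<lambda>x. (1 / c_max) *\<^sub>R x) ` poly_set r P"
          unfolding X using poly_gauge_le_scaled[OF compact] by blast
      next
        fix x assume "x \<in> (\<lambda>x. (1 / c_max) *\<^sub>R x) ` poly_set r P"
        then show "x \<in> ?X"
          unfolding X using c_max
          by (auto simp: poly_gauge_le_iff[OF compact] poly_set_def divide_right_mono)
      qed
      then have compact_X: "compact ?X" using compact by (simp add: compact_scaling)
      \<comment> \<open>This makes every admissible w nonnegative, so \<open>\<rho> ^ N * w\<close>
        is the root of the bound on \<open>V_delta\<close>. The origin keeps the infimum from
        ranging over an empty set.\<close>
      have w_min: "0 \<le> (INF (x, u)\<in>?Z. w_delta A B E \<Theta> D K r P x u 0)"
        using zero_in_constr_set[of p Lx Lu] w_nonneg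
        by (intro cINF_greatest) (auto simp: w_delta_def)
      show ?case
        unfolding c_max_def[symmetric] d_max_def[symmetric]
      proof (intro allI impI, goal_cases)
        case (1 P\<^sub>f)
        then have small: "\<rho> + ?L + c_max * d_max \<le> 1"
          and P\<^sub>f: "P\<^sub>f = transpose ?A ** P\<^sub>f ** ?A + Q + transpose K ** R ** K"
          by blast+
        have step: "(x' + d\<^sub>w, s') \<in> terminal_set r P c_max"
            "\<forall>j\<in>{1..p}. constr Lx Lu j x (K *v x) + ?c j * s \<le> 0"
          if x: "(x, s) \<in> terminal_set r P c_max" and w: "0 \<le> w"
            and s': "0 \<le> s'" "s' \<le> \<rho> * s - \<rho> ^ N * w + w_delta A B E \<Theta> D K r P x (K *v x) s"
            and x': "x' = ?A *v x"
            and d\<^sub>w: "V_delta r P (x' + d\<^sub>w) x' (K *v x') \<le> \<rho> ^ (2 * N) * w\<^sup>2"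
          for N :: nat and x x' d\<^sub>w s s' w
        proof -
          have s: "0 \<le> s" and Gs: "?G x + s \<le> 1 / c_max" using x by (simp_all add: terminal_iff)
          have "?G d\<^sub>w \<le> \<rho> ^ N * w"
            using V_le[of "\<rho> ^ N * w" "x' + d\<^sub>w" x' "K *v x'"] d\<^sub>w w \<rho>
            by (simp add: power_mult_distrib power_even_eq)
          \<comment> \<open>The gauge of the disturbance, at most \<open>\<rho> ^ N * w\<close>,
            cancels against the same term subtracted in the bound on s'.\<close>
          then have "?G (x' + d\<^sub>w) + s' \<le> \<rho> * (?G x + s) + w_delta A B E \<Theta> D K r P x (K *v x) s"
            using poly_gauge_add[OF compact, of x' d\<^sub>w] contract[of x] s'(2)
            unfolding x' by (simp add: distrib_left)
          \<comment> \<open>The shift from the origin has radius \<open>?G x\<close>; the remaining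
            value at the origin is at most \<open>d_max\<close>.\<close>
          also have "w_delta A B E \<Theta> D K r P x (K *v x) s \<le> d_max + ?L * (?G x + s)"
            using w_shift[of x 0 "?G x" 0] w_tilde_origin[OF assms(1,2) compact, of A B E D]
            by (simp add: w_delta_def feedback_def d_max_def algebra_simps)
          also have "\<rho> * (?G x + s) + (d_max + ?L * (?G x + s))
              \<le> \<rho> * (1 / c_max) + (d_max + ?L * (1 / c_max))"
            using Gs \<rho> L_nonneg by (intro add_mono mult_left_mono) auto
          also have "\<dots> = (\<rho> + ?L + c_max * d_max) / c_max"
            using c_max by (simp add: field_simps)
          also have "\<dots> \<le> 1 / c_max" using small c_max by (intro divide_right_mono) auto
          finally show "(x' + d\<^sub>w, s') \<in> terminal_set r P c_max"
            using s'(1) by (simp add: terminal_iff)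
          show "\<forall>j\<in>{1..p}. constr Lx Lu j x (K *v x) + ?c j * s \<le> 0"
          proof
            fix j assume "j \<in> {1..p}"
            then have "?c j \<le> c_max" by (simp add: c_max_def)
            have "Lx j \<bullet> x + Lu j \<bullet> (K *v x) \<le> ?c j * ?G x"
              by (rule tightening_bound[OF compact order_refl])
            \<comment> \<open>The right-hand side is 1, exactly the constant subtracted in
              \<open>constr\<close>.\<close>
            moreover have "?c j * (?G x + s) \<le> c_max * (1 / c_max)"
              using \<open>?c j \<le> c_max\<close> Gs c_max s nonneg by (intro mult_mono) auto
            ultimately show "constr Lx Lu j x (K *v x) + ?c j * s \<le> 0"
              using c_max by (simp add: constr_def distrib_left)
          qed
        qed
        obtain C where C: "0 < C"
            "\<And>x z. x \<in> ?X \<Longrightarrow> z \<in> ?X \<Longrightarrow> z \<bullet> (P\<^sub>f *v z) \<le> x \<bullet> (P\<^sub>f *v x) + C * norm (x - z)"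
          using quadratic_form_lipschitz[OF compact_imp_bounded[OF compact_X], of P\<^sub>f] by blast
        show ?case
        proof (intro conjI, goal_cases)
          case 1
          show ?case
          proof (intro allI impI, goal_cases)
            case (1 N x s w s' x' d\<^sub>w)
            then show ?case
              using step[of x s w s' N x' d\<^sub>w] w_min lyapunov_decrease[OF P\<^sub>f, of x]
              by (simp add: nominal_closed_loop)
          qed
        next
          case 2
          show ?case using compact_X by simp
        next
          case 3
          show ?case
            using class_K_inf_linear[OF C(1)] C(2) by (intro exI[of _ "\<lambda>t. C * t"]) auto
        qed
      qed
    qed
  qed
qed

end
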